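(* Let $G$ be a finitely generated group with large product growth, and let $A\subseteq G$ be a non-empty approximate semigroup. If $$\lim_{n\to\infty}\frac1n\log|A\cap B_n|=0,$$ then $|A\cap B_n|$ is polynomially bounded as a function of $n$.
   Context: $G$ is equipped with a fixed finite generating set, and $B_n$ denotes the ball of radius $n$ around the identity in the corresponding word metric. The group $G$ has large product growth if there exists a polynomial $P$ such that, for all $n,k$ and all finite subsets $U\subseteq B_n$ and $V\subseteq B_k$, $|UV|\ge\frac{|U|\,|V|}{P(n+k)}$, where $UV=\{uv:u\in U,v\in V\}$. A subset $A\subseteq G$ is an approximate semigroup if there is a finite subset $X\subseteq G$ such that $A^2\subseteq AX$, where $A^2=AA$. *)

theory Defs
  imports "HOL-Algebra.Generated_Groups" "HOL-Computational_Algebra.Polynomial"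
begin

definition is_word_for :: "('a, 'b) monoid_scheme \<Rightarrow> 'a set \<Rightarrow> 'a list \<Rightarrow> 'a \<Rightarrow> bool" where
  "is_word_for G S ws g \<longleftrightarrow>
     set ws \<subseteq> S \<union> m_inv G ` S \<and> foldr (monoid.mult G) ws \<one>\<^bsub>G\<^esub> = g"

(* Only meaningful for g in the subgroup generated by S: otherwise no word represents g
   and LEAST is unspecified. *)
definition word_length :: "('a, 'b) monoid_scheme \<Rightarrow> 'a set \<Rightarrow> 'a \<Rightarrow> nat" where
  "word_length G S g = (LEAST m. \<exists>ws. length ws = m \<and> is_word_for G S ws g)"

definition word_dist :: "('a, 'b) monoid_scheme \<Rightarrow> 'a set \<Rightarrow> 'a \<Rightarrow> 'a \<Rightarrow> nat" where
  "word_dist G S g h = word_length G S (inv\<^bsub>G\<^esub> g \<otimes>\<^bsub>G\<^esub> h)"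

definition word_ball :: "('a, 'b) monoid_scheme \<Rightarrow> 'a set \<Rightarrow> nat \<Rightarrow> 'a set" where
  "word_ball G S n = {g \<in> carrier G. word_dist G S \<one>\<^bsub>G\<^esub> g \<le> n}"

(* P is required to be positive at the naturals: the growth inequality would otherwise hold
   vacuously for negative P, or because x / 0 = 0. *)
definition large_product_growth :: "('a, 'b) monoid_scheme \<Rightarrow> 'a set \<Rightarrow> bool" where
  "large_product_growth G S \<longleftrightarrow>
     (\<exists>P :: real poly. (\<forall>m::nat. poly P (real m) > 0) \<and>
       (\<forall>n k U V. finite U \<longrightarrow> finite V \<longrightarrow> U \<subseteq> word_ball G S n \<longrightarrow> V \<subseteq> word_ball G S k \<longrightarrow>
          real (card (U <#>\<^bsub>G\<^esub> V)) \<ge> real (card U) * real (card V) / poly P (real (n + k))))"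

definition approximate_semigroup :: "('a, 'b) monoid_scheme \<Rightarrow> 'a set \<Rightarrow> bool" where
  "approximate_semigroup G A \<longleftrightarrow>
     A \<subseteq> carrier G \<and>
     (\<exists>X. finite X \<and> X \<subseteq> carrier G \<and> A <#>\<^bsub>G\<^esub> A \<subseteq> A <#>\<^bsub>G\<^esub> X)"

definition polynomially_bounded :: "(nat \<Rightarrow> nat) \<Rightarrow> bool" where
  "polynomially_bounded f \<longleftrightarrow> (\<exists>Q :: real poly. \<forall>n. real (f n) \<le> poly Q (real n))"

end

theory Submission
  imports Defs
begin

text \<open>
  Write \<open>a n\<close> for the number of elements of \<open>A\<close> in the ball of radius \<open>n\<close>.  Squaring
  \<open>A \<inter> B\<^sub>n\<close> inside \<open>A\<close> almost works: if \<open>AA \<subseteq> AX\<close> and \<open>X\<close> lies in the ball of radius \<open>r\<close>, then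
  \<open>(A \<inter> B\<^sub>n)(A \<inter> B\<^sub>n) \<subseteq> (A \<inter> B\<^bsub>2n+r\<^esub>) X\<close>, because dividing on the right by an element of \<open>X\<close> changes
  the length by at most \<open>r\<close>.  Large product growth bounds the left side from below, so
  \<open>a n ^ 2 \<le> p n * a (2 n + r)\<close> for a polynomial \<open>p\<close> (lemma \<open>approximate_semigroup_doubling\<close>).

  This inequality leaves no room between polynomial and exponential growth
  (lemma \<open>doubling_subexponential_imp_polynomially_bounded\<close>).  A suitable polynomial \<open>Q n = K * (n + r) ^ d\<close> absorbs the
  factor \<open>p n\<close>, so that \<open>c n = a n / Q n\<close> satisfies \<open>c (2 n + r) \<ge> c n ^ 2\<close>.  Were \<open>c n > 1\<close> for a
  single \<open>n\<close>, then squaring along the iterates of \<open>n \<mapsto> 2 n + r\<close>, which grow like \<open>2 ^ i\<close>, would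
  make \<open>c\<close>, and with it \<open>a\<close>, exponentially large, against the assumption on the limit.
  Hence \<open>a n \<le> Q n\<close> for every \<open>n\<close>.
\<close>

section \<open>Balls in the word metric\<close>

lemma (in group) foldr_mult_closed:
  "set ws \<subseteq> carrier G \<Longrightarrow> foldr (\<otimes>) ws \<one> \<in> carrier G"
  by (induction ws) auto

lemma (in group) foldr_mult_append:
  "set us \<subseteq> carrier G \<Longrightarrow> set vs \<subseteq> carrier G \<Longrightarrow>
     foldr (\<otimes>) (us @ vs) \<one> = foldr (\<otimes>) us \<one> \<otimes> foldr (\<otimes>) vs \<one>"
proof (induction us)
  case Nil
  then show ?case using foldr_mult_closed by simp
next
  case (Cons u us)
  then show ?case by (simp add: m_assoc foldr_mult_closed del: foldr_append)
qed

lemma (in group) is_word_for_append: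
  assumes "S \<subseteq> carrier G" "is_word_for G S us g" "is_word_for G S vs h"
  shows "is_word_for G S (us @ vs) (g \<otimes> h)"
proof -
  have "S \<union> m_inv G ` S \<subseteq> carrier G" using assms(1) by auto
  then have "set us \<subseteq> carrier G" "set vs \<subseteq> carrier G"
    using assms unfolding is_word_for_def by blast+
  then show ?thesis
    using assms foldr_mult_append unfolding is_word_for_def by auto
qed

lemma (in group) is_word_for_inv:
  assumes S: "S \<subseteq> carrier G" and "is_word_for G S ws g"
  shows "is_word_for G S (rev (map (m_inv G) ws)) (inv g)"
  using assms(2)
proof (induction ws arbitrary: g)
  case Nil
  then show ?case unfolding is_word_for_def by auto
next
  case (Cons w ws)
  define h where "h = foldr (\<otimes>) ws \<one>"
  have w: "w \<in> S \<union> m_inv G ` S" and h: "is_word_for G S ws h" and g: "g = w \<otimes> h"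
    using Cons.prems by (auto simp: is_word_for_def h_def)
  have wG: "w \<in> carrier G" using w S by auto
  have "set ws \<subseteq> carrier G" using Cons.prems S by (auto simp: is_word_for_def)
  then have hG: "h \<in> carrier G" unfolding h_def by (rule foldr_mult_closed)
  have "inv w \<in> S \<union> m_inv G ` S" using w S by auto
  then have "is_word_for G S [inv w] (inv w)"
    using wG by (simp add: is_word_for_def)
  from is_word_for_append[OF S Cons.IH[OF h] this]
  show ?case using wG hG g by (simp add: inv_mult_group)
qed

lemma (in group) generate_has_word:
  assumes S: "S \<subseteq> carrier G" and "g \<in> generate G S"
  shows "\<exists>ws. is_word_for G S ws g"
  using assms(2)
proof induction
  case one
  have "is_word_for G S [] \<one>" by (simp add: is_word_for_def)
  then show ?case ..
next
  case (incl h)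
  then have "is_word_for G S [h] h" using S by (auto simp: is_word_for_def)
  then show ?case ..
next
  case (inv h)
  then have "is_word_for G S [inv h] (inv h)" using S by (auto simp: is_word_for_def)
  then show ?case ..
next
  case (eng h1 h2)
  then show ?case using is_word_for_append[OF S] by blast
qed

text \<open>
  A ball is described by representing words, without reference to shortest ones.  The hypothesis
  that \<open>S\<close> generates matters for the forward direction: only then is the length of an element
  attained by a word.
\<close>

lemma (in group) word_ball_iff:
  assumes S: "S \<subseteq> carrier G" and gen: "generate G S = carrier G"
  shows "g \<in> word_ball G S n \<longleftrightarrow>
    g \<in> carrier G \<and> (\<exists>ws. length ws \<le> n \<and> is_word_for G S ws g)"
proof (cases "g \<in> carrier G")
  case True
  let ?Q = "\<lambda>m. \<exists>ws. length ws = m \<and> is_word_for G S ws g"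
  have "\<exists>m. ?Q m" using generate_has_word[OF S] gen True by blast
  then have least: "?Q (Least ?Q)" by (rule LeastI_ex)
  have "word_dist G S \<one> g = Least ?Q"
    using True by (simp add: word_dist_def word_length_def)
  moreover have "Least ?Q \<le> n \<longleftrightarrow> (\<exists>m\<le>n. ?Q m)"
  proof
    show "\<exists>m\<le>n. ?Q m" if "Least ?Q \<le> n" using that least by blast
  next
    assume "\<exists>m\<le>n. ?Q m"
    then obtain m where "m \<le> n" "?Q m" by blast
    from this(2) have "Least ?Q \<le> m" by (rule Least_le)
    then show "Least ?Q \<le> n" using \<open>m \<le> n\<close> by linarith
  qed
  ultimately show ?thesis using True by (auto simp: word_ball_def)
qed (simp add: word_ball_def)

lemma (in group) finite_word_ball:
  assumes "S \<subseteq> carrier G" "generate G S = carrier G" "finite S"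
  shows "finite (word_ball G S n)"
proof (rule finite_subset)
  let ?L = "{ws. set ws \<subseteq> S \<union> m_inv G ` S \<and> length ws \<le> n}"
  show "word_ball G S n \<subseteq> (\<lambda>ws. foldr (\<otimes>) ws \<one>) ` ?L"
    using word_ball_iff[OF assms(1,2)] by (auto simp: is_word_for_def)
  show "finite ((\<lambda>ws. foldr (\<otimes>) ws \<one>) ` ?L)"
    using assms(3) by (intro finite_imageI finite_lists_length_le) simp
qed

lemma (in group) word_ball_mult:
  assumes "S \<subseteq> carrier G" "generate G S = carrier G"
    and "g \<in> word_ball G S m" "h \<in> word_ball G S n"
  shows "g \<otimes> h \<in> word_ball G S (m + n)"
proof -
  from assms obtain us vs where
    "g \<in> carrier G" "length us \<le> m" "is_word_for G S us g"
    "h \<in> carrier G" "length vs \<le> n" "is_word_for G S vs h"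
    unfolding word_ball_iff[OF assms(1,2)] by auto
  moreover from this have "is_word_for G S (us @ vs) (g \<otimes> h)" "length (us @ vs) \<le> m + n"
    using is_word_for_append[OF assms(1)] by auto
  ultimately show ?thesis unfolding word_ball_iff[OF assms(1,2)] by blast
qed

lemma (in group) word_ball_inv:
  assumes "S \<subseteq> carrier G" "generate G S = carrier G" and "g \<in> word_ball G S n"
  shows "inv g \<in> word_ball G S n"
proof -
  from assms obtain ws where "g \<in> carrier G" "length ws \<le> n" "is_word_for G S ws g"
    unfolding word_ball_iff[OF assms(1,2)] by auto
  moreover from this have "is_word_for G S (rev (map (m_inv G) ws)) (inv g)"
    "length (rev (map (m_inv G) ws)) \<le> n"
    using is_word_for_inv[OF assms(1)] by auto
  ultimately show ?thesis unfolding word_ball_iff[OF assms(1,2)] by blast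
qed

lemma (in group) finite_subset_word_ball:
  assumes S: "S \<subseteq> carrier G" "generate G S = carrier G" and "finite X" "X \<subseteq> carrier G"
  obtains r where "X \<subseteq> word_ball G S r" "r > 0"
proof
  define r where "r = Suc (Max (insert 0 (word_dist G S \<one> ` X)))"
  show "X \<subseteq> word_ball G S r"
  proof
    fix x assume "x \<in> X"
    then have "word_dist G S \<one> x \<le> Max (insert 0 (word_dist G S \<one> ` X))"
      using assms(3) by (intro Max_ge) auto
    then show "x \<in> word_ball G S r"
      using \<open>x \<in> X\<close> assms(4) by (auto simp: word_ball_def r_def)
  qed
  show "r > 0" by (simp add: r_def)
qed

section \<open>The doubling inequality for approximate semigroups\<close>

text \<open>
  A product of two elements of \<open>A \<inter> B\<^sub>n\<close> has length at most \<open>2 n\<close> and has the form \<open>a x\<close> with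
  \<open>a \<in> A\<close>, \<open>x \<in> X\<close>.  Solving for \<open>a\<close> bounds its length by \<open>2 n + r\<close>, where \<open>r\<close> is the radius of
  a ball containing \<open>X\<close>; such a radius can be enlarged freely, so \<open>r > 0\<close> is no restriction.
\<close>

lemma (in group) approximate_semigroup_doubling:
  assumes S: "S \<subseteq> carrier G" "generate G S = carrier G" and "finite S"
    and "large_product_growth G S" and "approximate_semigroup G A"
  obtains p :: "real poly" and r where "r > 0"
    and "\<And>n. real (card (A \<inter> word_ball G S n)) ^ 2
            \<le> poly p (real n) * real (card (A \<inter> word_ball G S (2 * n + r)))"
proof -
  let ?A = "\<lambda>n. A \<inter> word_ball G S n"
  have finA: "finite (?A n)" for n
    using finite_word_ball[OF S \<open>finite S\<close>] by blast
  obtain P :: "real poly" where pos: "\<And>m::nat. poly P (real m) > 0"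
    and growth: "\<And>n k U V. finite U \<Longrightarrow> finite V \<Longrightarrow> U \<subseteq> word_ball G S n \<Longrightarrow> V \<subseteq> word_ball G S k \<Longrightarrow>
        real (card (U <#>\<^bsub>G\<^esub> V)) \<ge> real (card U) * real (card V) / poly P (real (n + k))"
    using assms(4) unfolding large_product_growth_def by blast
  obtain X where AG: "A \<subseteq> carrier G" and X: "finite X" "X \<subseteq> carrier G"
    and AX: "A <#> A \<subseteq> A <#> X"
    using assms(5) unfolding approximate_semigroup_def by blast
  obtain r where r: "X \<subseteq> word_ball G S r" "r > 0"
    using finite_subset_word_ball[OF S X] .
  define p where "p = smult (real (card X)) (pcompose P [:0, 2:])"
  have "real (card (?A n)) ^ 2 \<le> poly p (real n) * real (card (?A (2 * n + r)))" for n
  proof -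
    have "?A n <#> ?A n \<subseteq> ?A (2 * n + r) <#> X"
    proof
      fix g assume "g \<in> ?A n <#> ?A n"
      then have g: "g \<in> A <#> A" "g \<in> word_ball G S (n + n)"
        using word_ball_mult[OF S] by (auto simp: set_mult_def)
      then obtain a x where ax: "a \<in> A" "x \<in> X" "g = a \<otimes> x"
        using AX unfolding set_mult_def by blast
      then have "a = g \<otimes> inv x"
        using AG X(2) by (simp add: inv_solve_right' subset_eq m_assoc)
      moreover have "g \<otimes> inv x \<in> word_ball G S (n + n + r)"
        using g(2) ax(2) r(1) by (intro word_ball_mult[OF S] word_ball_inv[OF S]) auto
      ultimately have "a \<in> ?A (2 * n + r)" using ax(1) by (simp add: mult_2)
      then show "g \<in> ?A (2 * n + r) <#> X" using ax unfolding set_mult_def by blast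
    qed
    moreover have AX_image: "?A (2 * n + r) <#> X = (\<lambda>(a, x). a \<otimes> x) ` (?A (2 * n + r) \<times> X)"
      unfolding set_mult_def by auto
    ultimately have "card (?A n <#> ?A n) \<le> card ((\<lambda>(a, x). a \<otimes> x) ` (?A (2 * n + r) \<times> X))"
      using finA X(1) by (intro card_mono finite_imageI finite_cartesian_product) simp_all
    also have "\<dots> \<le> card (?A (2 * n + r) \<times> X)"
      using finA X(1) by (intro card_image_le finite_cartesian_product)
    finally have "card (?A n <#> ?A n) \<le> card (?A (2 * n + r) \<times> X)" .
    then have "card (?A n <#> ?A n) \<le> card (?A (2 * n + r)) * card X"
      by (simp add: card_cartesian_product)
    then have "real (card (?A n <#> ?A n)) \<le> real (card (?A (2 * n + r))) * real (card X)"
      by (metis of_nat_le_iff of_nat_mult)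
    moreover have "real (card (?A n)) * real (card (?A n)) / poly P (real (n + n))
        \<le> real (card (?A n <#> ?A n))"
      by (rule growth) (use finA in auto)
    ultimately have "real (card (?A n)) * real (card (?A n)) / poly P (real (n + n))
        \<le> real (card (?A (2 * n + r))) * real (card X)" by linarith
    then have "real (card (?A n)) ^ 2
        \<le> real (card (?A (2 * n + r))) * real (card X) * poly P (real (n + n))"
      by (simp only: pos_divide_le_eq[OF pos] power2_eq_square)
    then show ?thesis by (simp add: p_def poly_pcompose mult_ac)
  qed
  with r(2) show thesis by (rule that)
qed

section \<open>Doubling forces polynomial or exponential growth\<close>

lemma poly_le_power:
  fixes p :: "real poly"
  obtains C where "C \<ge> 1" "\<And>x y. 0 \<le> x \<Longrightarrow> x \<le> y \<Longrightarrow> 1 \<le> y \<Longrightarrow> poly p x \<le> C * y ^ degree p"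
proof
  define C where "C = 1 + (\<Sum>i\<le>degree p. \<bar>coeff p i\<bar>)"
  have nonneg: "(\<Sum>i\<le>degree p. \<bar>coeff p i\<bar>) \<ge> 0" by (intro sum_nonneg) auto
  then show "C \<ge> 1" by (simp add: C_def)
  fix x y :: real
  assume xy: "0 \<le> x" "x \<le> y" "1 \<le> y"
  have "poly p x = (\<Sum>i\<le>degree p. coeff p i * x ^ i)" by (rule poly_altdef)
  also have "\<dots> \<le> (\<Sum>i\<le>degree p. \<bar>coeff p i\<bar> * y ^ degree p)"
  proof (rule sum_mono)
    fix i assume "i \<in> {..degree p}"
    then have "x ^ i \<le> y ^ degree p"
      using xy by (meson atMost_iff order_trans power_increasing power_mono)
    then show "coeff p i * x ^ i \<le> \<bar>coeff p i\<bar> * y ^ degree p"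
      using xy by (intro mult_mono) auto
  qed
  also have "\<dots> = (\<Sum>i\<le>degree p. \<bar>coeff p i\<bar>) * y ^ degree p"
    by (simp add: sum_distrib_right)
  also have "\<dots> \<le> C * y ^ degree p"
    using xy by (intro mult_right_mono) (auto simp: C_def)
  finally show "poly p x \<le> C * y ^ degree p" .
qed

lemma power_two_power_le_iterate:
  fixes c :: "nat \<Rightarrow> real"
  assumes sq: "\<And>n. c n ^ 2 \<le> c (f n)" and "c n \<ge> 0"
  shows "c n ^ (2 ^ i) \<le> c ((f ^^ i) n)"
proof (induction i)
  case (Suc i)
  have "c n ^ (2 ^ Suc i) = (c n ^ (2 ^ i)) ^ 2" by (simp add: power_mult[symmetric] mult.commute)
  also have "\<dots> \<le> c ((f ^^ i) n) ^ 2"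
    using Suc assms(2) by (intro power_mono) auto
  also have "\<dots> \<le> c ((f ^^ Suc i) n)" using sq by simp
  finally show ?case .
qed simp

text \<open>
  The shift \<open>n + r\<close> linearises the map \<open>n \<mapsto> 2 n + r\<close>, since \<open>(2 n + r) + r = 2 (n + r)\<close>; this is
  why the normalising polynomial is a power of \<open>n + r\<close>.  Positivity of \<open>r\<close> makes the iterates
  tend to infinity from every starting point, zero included.
\<close>

lemma doubling_subexponential_imp_polynomially_bounded:
  fixes a :: "nat \<Rightarrow> nat" and p :: "real poly"
  assumes r: "r > 0"
    and doubling: "\<And>n. real (a n) ^ 2 \<le> poly p (real n) * real (a (2 * n + r))"
    and subexp: "(\<lambda>n. 1 / real n * ln (real (a n))) \<longlonglongrightarrow> 0"
  shows "polynomially_bounded a"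
proof -
  define d where "d = degree p"
  obtain C where C: "C \<ge> 1"
    "\<And>x y. 0 \<le> x \<Longrightarrow> x \<le> y \<Longrightarrow> 1 \<le> y \<Longrightarrow> poly p x \<le> C * y ^ d"
    unfolding d_def using poly_le_power[of p] by metis
  \<comment> \<open>The constant is the one for which \<open>Q (2 n + r) * (C * (n + r) ^ d) = Q n ^ 2\<close>.\<close>
  define K where "K = 2 ^ d * C"
  define Q where "Q n = K * real (n + r) ^ d" for n
  define c where "c n = real (a n) / Q n" for n
  have "K \<ge> 1" unfolding K_def using C(1) mult_mono[of 1 "2 ^ d" 1 C] by simp
  then have Q1: "Q n \<ge> 1" for n
    unfolding Q_def using r mult_mono[of 1 K 1 "real (n + r) ^ d"] by simp
  have Q_square: "Q n ^ 2 = C * real (n + r) ^ d * Q (2 * n + r)" for n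
  proof -
    have "real (2 * n + r + r) = 2 * real (n + r)" by simp
    then show ?thesis
      unfolding Q_def K_def by (simp only: power_mult_distrib power2_eq_square mult_ac)
  qed
  have square: "c n ^ 2 \<le> c (2 * n + r)" for n
  proof -
    define F where "F = C * real (n + r) ^ d"
    have F: "F > 0" unfolding F_def using C(1) r by simp
    have "real (a n) ^ 2 \<le> poly p (real n) * real (a (2 * n + r))" by (rule doubling)
    also have "\<dots> \<le> F * real (a (2 * n + r))"
      unfolding F_def using r by (intro mult_right_mono C(2)) auto
    finally have "real (a n) ^ 2 / Q n ^ 2 \<le> F * real (a (2 * n + r)) / Q n ^ 2"
      by (rule divide_right_mono) simp
    also have "\<dots> = real (a (2 * n + r)) / Q (2 * n + r)"
      unfolding Q_square F_def[symmetric] using F by simp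
    finally show ?thesis unfolding c_def power_divide .
  qed
  have c_le: "c n \<le> 1" for n
  proof (rule ccontr)
    assume "\<not> c n \<le> 1"
    then have c1: "c n > 1" by simp
    define m where "m i = ((\<lambda>k. 2 * k + r) ^^ i) n" for i
    define e where "e = ln (c n) / real (n + r)"
    have "e > 0" unfolding e_def using c1 r by simp
    have m_shift: "m i + r = 2 ^ i * (n + r)" for i
      by (induction i) (auto simp: m_def algebra_simps)
    have m_ge: "m i \<ge> i" for i
    proof (induction i)
      case (Suc i)
      then show ?case using r by (simp add: m_def)
    qed simp
    then have "filterlim m at_top sequentially"
      by (intro filterlim_at_top_mono[OF filterlim_ident]) auto
    from filterlim_compose[OF subexp this]
    have "\<forall>\<^sub>F i in sequentially. 1 / real (m i) * ln (real (a (m i))) < e"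
      using \<open>e > 0\<close> by (auto dest: order_tendstoD(2))
    moreover have "\<forall>\<^sub>F i in sequentially. i \<ge> 1" by (rule eventually_ge_at_top)
    ultimately have "\<forall>\<^sub>F i in sequentially. i \<ge> 1 \<and> 1 / real (m i) * ln (real (a (m i))) < e"
      by eventually_elim simp
    then obtain i where i: "i \<ge> 1" "1 / real (m i) * ln (real (a (m i))) < e"
      unfolding eventually_sequentially by blast
    have mpos: "real (m i) > 0" using m_ge[of i] i(1) by simp
    have "c n ^ (2 ^ i) \<le> c (m i)"
      unfolding m_def using c1 by (intro power_two_power_le_iterate square) auto
    also have "\<dots> \<le> real (a (m i))"
      unfolding c_def using divide_left_mono[of 1 "Q (m i)" "real (a (m i))"] Q1[of "m i"] by simp
    finally have "ln (c n ^ (2 ^ i)) \<le> ln (real (a (m i)))"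
      using c1 by (intro ln_mono) auto
    then have "2 ^ i * ln (c n) \<le> ln (real (a (m i)))"
      using c1 by (simp add: ln_realpow)
    moreover have "e * real (m i) \<le> 2 ^ i * ln (c n)"
    proof -
      have "real (m i) \<le> real (2 ^ i * (n + r))" using m_shift[of i] by linarith
      then have "e * real (m i) \<le> e * (2 ^ i * real (n + r))"
        using \<open>e > 0\<close> by (intro mult_left_mono) auto
      also have "\<dots> = 2 ^ i * ln (c n)" unfolding e_def using r by simp
      finally show ?thesis .
    qed
    ultimately have "e \<le> 1 / real (m i) * ln (real (a (m i)))"
      using mpos by (simp add: pos_le_divide_eq)
    with i(2) show False by simp
  qed
  have "real (a n) \<le> poly (smult K ([:real r, 1:] ^ d)) (real n)" for n
  proof -
    have "real (a n) \<le> Q n" using c_le[of n] Q1[of n] by (simp add: c_def divide_le_eq)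
    then show ?thesis by (simp add: Q_def poly_power add.commute)
  qed
  then show ?thesis unfolding polynomially_bounded_def by blast
qed

theorem corollary4p6:
  fixes G :: "('a, 'b) monoid_scheme" and S A :: "'a set"
  assumes "group G"
    and "finite S" and "S \<subseteq> carrier G" and "generate G S = carrier G"
    and "large_product_growth G S"
    and "approximate_semigroup G A" and "A \<noteq> {}"
    and "(\<lambda>n. 1 / real n * ln (real (card (A \<inter> word_ball G S n)))) \<longlonglongrightarrow> 0"
  shows "polynomially_bounded (\<lambda>n. card (A \<inter> word_ball G S n))"
proof -
  obtain p :: "real poly" and r where "r > 0"
    and "\<And>n. real (card (A \<inter> word_ball G S n)) ^ 2
            \<le> poly p (real n) * real (card (A \<inter> word_ball G S (2 * n + r)))"
    using group.approximate_semigroup_doubling[OF assms(1,3,4,2,5,6)] by blast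
  then show ?thesis using assms(8) by (rule doubling_subexponential_imp_polynomially_bounded)
qed

end
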